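(* Let $m$ be an odd positive integer and let $F:\mathbb{F}_{2^m}^3\to\mathbb{F}_{2^m}^3$ be defined by $F(x,y,z)=(f(x,y,z),f(y,z,x),f(z,x,y))$, where $f(x,y,z)=x^3+yz^2+y^2z$. Then $F$ is a permutation of $\mathbb{F}_{2^m}^3$.
   Context: $\mathbb{F}_{2^m}$ denotes the finite field with $2^m$ elements and $\mathbb{F}_{2^m}^3$ the 3-dimensional vector space over it. A permutation of $\mathbb{F}_{2^m}^3$ is a bijection from $\mathbb{F}_{2^m}^3$ to itself. *)

theory Defs
  imports Main "HOL-Library.Cardinality"
begin

definition f_comp :: "'a::field \<Rightarrow> 'a \<Rightarrow> 'a \<Rightarrow> 'a" where
  "f_comp x y z = x ^ 3 + y * z ^ 2 + y ^ 2 * z"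

definition F_map :: "'a::field \<times> 'a \<times> 'a \<Rightarrow> 'a \<times> 'a \<times> 'a" where
  "F_map = (\<lambda>(x, y, z). (f_comp x y z, f_comp y z x, f_comp z x y))"

end

theory Submission
  imports Defs
begin

text \<open>
  Put \<open>s = x + y + z\<close>, \<open>p = x + z\<close>, \<open>r = y + z\<close> and \<open>N = p\<^sup>2 + p r + r\<^sup>2\<close>. In characteristic 2 the
  three components of \<open>F\<close> sum to \<open>s\<^sup>3\<close>, while adding the third to each of the first two gives \<open>N p\<close>
  and \<open>N r\<close>. (If \<open>\<omega>\<close> is a primitive cube root of unity and \<open>u = p + \<omega> r\<close>, then \<open>N\<close> is the norm of
  \<open>u\<close>, and \<open>F\<close> becomes \<open>(s, u) \<mapsto> (s\<^sup>3, N u)\<close>.) The form \<open>N\<close> takes the value \<open>N\<^sup>3\<close> at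
  \<open>(N p, N r)\<close>. As \<open>m\<close> is odd, 3 is coprime to \<open>2\<^sup>m - 1\<close>, so cubing is injective; hence
  \<open>F(x, y, z)\<close> determines \<open>s\<close> and \<open>N\<close>, and thereby \<open>p\<close> and \<open>r\<close>, since \<open>N\<close> vanishes only at the origin.
\<close>

text \<open>Multiplication by \<open>a\<close> permutes the nonzero elements, so their nonzero
  product cancels.\<close>

lemma finite_field_power_card_minus_1:
  fixes a :: "'a::{field,finite}"
  assumes "a \<noteq> 0"
  shows "a ^ (CARD('a) - 1) = 1"
proof -
  let ?U = "UNIV - {0::'a}"
  have bij: "bij_betw (\<lambda>x. a * x) ?U ?U"
    using assms by (intro bij_betw_byWitness[where f' = "\<lambda>x. x / a"]) auto
  have "\<Prod>?U = (\<Prod>x\<in>?U. a * x)"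
    using prod.reindex_bij_betw[OF bij, of "\<lambda>x. x"] by simp
  also have "\<dots> = a ^ card ?U * \<Prod>?U"
    by (simp add: prod.distrib)
  finally show ?thesis
    by (simp add: card_Diff_singleton)
qed

lemma two_eq_0_if_even_card:
  assumes "even CARD('a::{field,finite})"
  shows "(2::'a) = 0"
proof -
  have "odd (CARD('a) - 1)"
    using assms zero_less_card_finite[where 'a = 'a] by presburger
  then have "(-1::'a) = 1"
    using finite_field_power_card_minus_1[of "-1::'a"] by simp
  then show ?thesis
    by (metis add.right_inverse one_add_one)
qed

lemma cube_inj_finite_field:
  fixes a b :: "'a::{field,finite}"
  assumes card: "CARD('a) mod 3 = 2" and eq: "a ^ 3 = b ^ 3"
  shows "a = b"
proof -
  \<comment> \<open>With q the field size, 2(q-1)+1 = 2q-1 is divisible by 3, so \<open>k\<close>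
    inverts 3 modulo q-1.\<close>
  obtain k where k: "2 * (CARD('a) - 1) + 1 = 3 * k"
    using card by (intro that[of "(2 * (CARD('a) - 1) + 1) div 3"]) presburger
  have root: "c = (c ^ 3) ^ k" if "c \<noteq> 0" for c :: 'a
  proof -
    have "(c ^ 3) ^ k = c ^ (2 * (CARD('a) - 1) + 1)"
      by (simp only: k power_mult)
    also have "\<dots> = c"
      using finite_field_power_card_minus_1[OF that]
      by (simp add: mult.commute[of 2] power_mult)
    finally show ?thesis by simp
  qed
  show ?thesis
  proof (cases "a = 0 \<or> b = 0")
    case True
    with eq show ?thesis by auto
  next
    case False
    then show ?thesis by (metis eq root)
  qed
qed

lemma F_map_inj:
  assumes two: "(2::'a::field) = 0"
    and cube: "\<And>a b :: 'a. a ^ 3 = b ^ 3 \<Longrightarrow> a = b"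
  shows "inj (F_map :: 'a \<times> 'a \<times> 'a \<Rightarrow> 'a \<times> 'a \<times> 'a)"
proof -
  define N :: "'a \<Rightarrow> 'a \<Rightarrow> 'a" where "N p r = p\<^sup>2 + p * r + r\<^sup>2" for p r
  \<comment> \<open>Reduces characteristic-2 identities to ring identities with explicit correction
    \<open>2 * K\<close>.\<close>
  have mod2: "a = b" if "b = a + 2 * K" for a b K :: 'a
    using that two by simp
  have sum: "f_comp x y z + f_comp y z x + f_comp z x y = (x + y + z) ^ 3" for x y z :: 'a
    by (rule mod2[where K = "x\<^sup>2 * y + x * y\<^sup>2 + y\<^sup>2 * z + y * z\<^sup>2 + z\<^sup>2 * x + z * x\<^sup>2 + 3 * x * y * z"])
      (simp add: f_comp_def power2_eq_square power3_eq_cube algebra_simps)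
  have fst: "f_comp x y z + f_comp z x y = N (x + z) (y + z) * (x + z)" for x y z :: 'a
    by (rule mod2[where K = "z ^ 3 + 3 * x * z\<^sup>2 + 2 * x\<^sup>2 * z + 2 * x * y * z + y * z\<^sup>2"])
      (simp add: f_comp_def N_def power2_eq_square power3_eq_cube algebra_simps)
  have snd: "f_comp y z x + f_comp z x y = N (x + z) (y + z) * (y + z)" for x y z :: 'a
    by (rule mod2[where K = "z ^ 3 + 3 * y * z\<^sup>2 + 2 * y\<^sup>2 * z + 2 * x * y * z + x * z\<^sup>2"])
      (simp add: f_comp_def N_def power2_eq_square power3_eq_cube algebra_simps)
  have N_scale: "N (N p r * p) (N p r * r) = N p r ^ 3" for p r
    unfolding N_def by algebra
  have N_zero: "p = 0 \<and> r = 0" if "N p r = 0" for p r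
  proof -
    \<comment> \<open>\<open>p ^ 3 - r ^ 3 = (p - r) * N p r\<close>.\<close>
    have "p ^ 3 = r ^ 3"
      using that unfolding N_def by algebra
    then have "p = r" by (rule cube)
    moreover have "p\<^sup>2 = N p r"
      by (rule mod2[where K = "p\<^sup>2"]) (simp add: N_def power2_eq_square \<open>p = r\<close>)
    ultimately show ?thesis using that by simp
  qed
  have N_inj: "p = p' \<and> r = r'"
    if eq: "N p r * p = N p' r' * p'" "N p r * r = N p' r' * r'" for p r p' r'
  proof -
    have "N p r = N p' r'"
      by (rule cube) (metis N_scale eq)
    \<comment> \<open>If the common value of \<open>N\<close> is 0, all four entries vanish;
      otherwise it cancels.\<close>
    then show ?thesis
      using eq N_zero by (metis mult_cancel_left)
  qed
  show ?thesis
  proof (rule injI)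
    fix v v' :: "'a \<times> 'a \<times> 'a"
    assume F_eq: "F_map v = F_map v'"
    obtain x y z x' y' z' where v: "v = (x, y, z)" "v' = (x', y', z')"
      by (metis prod_cases3)
    with F_eq have eq: "f_comp x y z = f_comp x' y' z'" "f_comp y z x = f_comp y' z' x'"
      "f_comp z x y = f_comp z' x' y'"
      by (auto simp: F_map_def)
    have s: "x + y + z = x' + y' + z'"
      by (rule cube) (metis sum eq)
    have pr: "x + z = x' + z' \<and> y + z = y' + z'"
      by (rule N_inj) (metis fst snd eq)+
    have "y = y'" using s pr by algebra
    with pr show "v = v'" unfolding v by auto
  qed
qed

theorem theorem3:
  fixes m :: nat
  assumes "odd m"
    and "CARD('a::{field,finite}) = 2 ^ m"
  shows "bij (F_map :: 'a \<times> 'a \<times> 'a \<Rightarrow> 'a \<times> 'a \<times> 'a)"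
proof -
  obtain k where m: "m = 2 * k + 1"
    using assms(1) by (auto elim: oddE)
  have "(4::nat) ^ k mod 3 = 1"
    by (subst power_mod[symmetric]) simp
  then have "CARD('a) mod 3 = 2"
    using mod_mult_right_eq[of 2 "4 ^ k" "3::nat"] by (simp add: assms(2) m power_mult)
  moreover have "even CARD('a)"
    by (simp add: assms(2) m)
  ultimately have "inj (F_map :: 'a \<times> 'a \<times> 'a \<Rightarrow> 'a \<times> 'a \<times> 'a)"
    using F_map_inj[OF two_eq_0_if_even_card cube_inj_finite_field] by blast
  then show ?thesis
    by (simp add: bij_def finite_UNIV_inj_surj)
qed

end
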